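(* Let $d\ge 2$ and $R\ge1$. Let $C\subseteq\mathbb{R}^d$ be a bounded $R$-fat Borel set and let $S$ be the family of all $2R$-fat Borel subsets of $\mathbb{R}^d$. Then $\mathrm{PropEF}(C,2,S)=\mathrm{Prop}(C,2,S)=1/2$.
   Context: For $R\ge1$, a $d$-dimensional piece (Borel subset of $\mathbb{R}^d$) is $R$-fat if it contains a $d$-dimensional cube $B^-$ and is contained in a $d$-dimensional cube $B^+$ parallel to $B^-$ with $\mathrm{len}(B^+)/\mathrm{len}(B^-)\le R$ (len = side length). A value measure on $C$ is $V(X)=\int_X v$ with $v$ non-negative, bounded, integrable on $C$, $V(C)<\infty$; $V^S(X):=\sup\{V(s):s\in S,s\subseteq X\}$. For $n$ agents with value measures $V_1,\dots,V_n$, an $S$-allocation is $(X_1,\dots,X_n)$ with $X_i\in S$ pairwise disjoint and $\bigcup_i X_i\subseteq C$; it is envy-free if $V_i^S(X_i)\ge V_i^S(X_j)$ for all $i,j$. $\mathrm{PropEF}(C,n,S):=\inf_{V_1,\dots,V_n}\sup_X\min_i V_i(X_i)/V_i(C)$, the infimum over all $n$-tuples of value measures on $C$ and the supremum over envy-free $S$-allocations; $\mathrm{Prop}(C,n,S)$ is defined identically with the supremum over all $S$-allocations. *)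

theory Defs
  imports "HOL-Analysis.Analysis"
begin

text \<open>A (possibly rotated) closed d-dimensional cube of side length a: the image of
  [0,a]^d under the rigid motion x \<mapsto> c + f x, with f an orthogonal transformation.
  Two cubes built with the same f are parallel.\<close>
definition cube :: "(real^'n \<Rightarrow> real^'n) \<Rightarrow> real^'n \<Rightarrow> real \<Rightarrow> (real^'n) set" where
  "cube f c a = {c + f x | x. \<forall>i. 0 \<le> x $ i \<and> x $ i \<le> a}"

definition fat :: "real \<Rightarrow> (real^'n) set \<Rightarrow> bool" where
  "fat R X \<longleftrightarrow> (\<exists>f c a c' b. orthogonal_transformation f \<and> 0 < a \<and> 0 < b \<and>
      cube f c a \<subseteq> X \<and> X \<subseteq> cube f c' b \<and> b / a \<le> R)"

definition VM :: "(real^'n \<Rightarrow> real) \<Rightarrow> (real^'n) set \<Rightarrow> real" where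
  "VM v X = (LINT x:X|lborel. v x)"

definition value_density :: "(real^'n) set \<Rightarrow> (real^'n \<Rightarrow> real) \<Rightarrow> bool" where
  "value_density C v \<longleftrightarrow> v \<in> borel_measurable borel \<and> (\<forall>x. 0 \<le> v x) \<and>
      (\<exists>M. \<forall>x. v x \<le> M) \<and> set_integrable lborel C v \<and> 0 < VM v C"

definition VS :: "(real^'n) set set \<Rightarrow> (real^'n \<Rightarrow> real) \<Rightarrow> (real^'n) set \<Rightarrow> real" where
  "VS S v X = Sup {VM v s | s. s \<in> S \<and> s \<subseteq> X}"

definition allocation :: "(real^'n) set \<Rightarrow> nat \<Rightarrow> (real^'n) set set \<Rightarrow> (nat \<Rightarrow> (real^'n) set) \<Rightarrow> bool" where
  "allocation C n S X \<longleftrightarrow> (\<forall>i<n. X i \<in> S) \<and> (\<forall>i<n. \<forall>j<n. i \<noteq> j \<longrightarrow> X i \<inter> X j = {}) \<and>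
      (\<Union>i<n. X i) \<subseteq> C"

definition envy_free :: "nat \<Rightarrow> (real^'n) set set \<Rightarrow> (nat \<Rightarrow> real^'n \<Rightarrow> real) \<Rightarrow> (nat \<Rightarrow> (real^'n) set) \<Rightarrow> bool" where
  "envy_free n S v X \<longleftrightarrow> (\<forall>i<n. \<forall>j<n. VS S (v i) (X j) \<le> VS S (v i) (X i))"

definition Prop :: "(real^'n) set \<Rightarrow> nat \<Rightarrow> (real^'n) set set \<Rightarrow> real" where
  "Prop C n S = Inf {Sup {Min ((\<lambda>i. VM (v i) (X i) / VM (v i) C) ` {..<n}) | X. allocation C n S X}
      | v. \<forall>i<n. value_density C (v i)}"

definition PropEF :: "(real^'n) set \<Rightarrow> nat \<Rightarrow> (real^'n) set set \<Rightarrow> real" where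
  "PropEF C n S = Inf {Sup {Min ((\<lambda>i. VM (v i) (X i) / VM (v i) C) ` {..<n}) | X. allocation C n S X \<and> envy_free n S v X}
      | v. \<forall>i<n. value_density C (v i)}"

end

theory Submission
  imports Defs
begin

text \<open>Cut and choose: agent 0 produces two disjoint \<open>2 R\<close>-fat pieces of equal value to her, together
  covering almost all of \<open>C\<close>, and agent 1 takes the one he prefers. To cut, take two disjoint cubes
  \<open>P\<close>, \<open>Q\<close> of almost half the side of the inner cube \<open>B\<^sup>-\<close>, at opposite corners of it. If \<open>P\<close> is worth
  at least as much as the rest, some smaller cube in \<open>P\<close> balances its complement, which is fat because it
  contains \<open>Q\<close>; likewise for \<open>Q\<close>. Otherwise a hyperplane sweeps across the remainder while \<open>P\<close> stays in
  the first piece and \<open>Q\<close> in the second, and by continuity the values agree at some moment. Equal agents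
  show that 1/2 cannot be exceeded.\<close>

section \<open>Cubes in the coordinates of an orthogonal frame\<close>

lemma coord_image:
  fixes f :: "real^'n \<Rightarrow> real^'n"
  assumes "orthogonal_transformation f"
  shows "f (axis i 1) \<bullet> f y = y $ i"
  using assms by (simp add: orthogonal_transformation_def inner_axis')

lemma coord_shift:
  fixes f :: "real^'n \<Rightarrow> real^'n"
  assumes "orthogonal_transformation f"
  shows "f (axis i 1) \<bullet> (x - (c + f (\<chi> j. w))) = f (axis i 1) \<bullet> (x - c) - w"
  using coord_image[OF assms, of i "\<chi> j. w"] by (simp add: inner_diff_right inner_add_right)

text \<open>Surjectivity of \<open>f\<close> lets every point be written as \<open>c + f y\<close>,
  and orthogonality recovers \<open>y\<close> by inner products. In this form inclusion, closedness
  and disjointness of parallel cubes become linear inequalities.\<close>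

lemma cube_eq:
  fixes f :: "real^'n \<Rightarrow> real^'n"
  assumes f: "orthogonal_transformation f"
  shows "cube f c a = {x. \<forall>i. 0 \<le> f (axis i 1) \<bullet> (x - c) \<and> f (axis i 1) \<bullet> (x - c) \<le> a}"
proof -
  have "\<exists>y. x = c + f y" for x
    using orthogonal_transformation_surj[OF f] by (metis add.commute diff_add_cancel surjD)
  then show ?thesis
    unfolding cube_def using coord_image[OF f] by (fastforce simp: set_eq_iff)
qed

lemma cube_shift_eq:
  fixes f :: "real^'n \<Rightarrow> real^'n"
  assumes f: "orthogonal_transformation f"
  shows "cube f (c + f (\<chi> j. w)) a =
    {x. \<forall>i. w \<le> f (axis i 1) \<bullet> (x - c) \<and> f (axis i 1) \<bullet> (x - c) \<le> w + a}"
  unfolding cube_eq[OF f] coord_shift[OF f] by (simp add: algebra_simps)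

text \<open>Testing the two extreme corners of the inner cube for membership in the outer one gives
  both inequalities.\<close>

lemma cube_subset_corner:
  fixes f :: "real^'n \<Rightarrow> real^'n"
  assumes f: "orthogonal_transformation f" and "0 \<le> a" and sub: "cube f c a \<subseteq> cube f c' b"
  shows "0 \<le> f (axis i 1) \<bullet> (c - c')" "f (axis i 1) \<bullet> (c - c') + a \<le> b"
proof -
  have "c \<in> cube f c a" "c + f (\<chi> j. a) \<in> cube f c a"
    using \<open>0 \<le> a\<close> coord_image[OF f] by (auto simp: cube_eq[OF f])
  then have "c \<in> cube f c' b" "c + f (\<chi> j. a) \<in> cube f c' b" using sub by auto
  moreover have "f (axis i 1) \<bullet> (c + f (\<chi> j. a) - c') = f (axis i 1) \<bullet> (c - c') + a"
    using coord_image[OF f, of i "\<chi> j. a"] by (simp add: inner_diff_right inner_add_right)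
  ultimately show "0 \<le> f (axis i 1) \<bullet> (c - c')" "f (axis i 1) \<bullet> (c - c') + a \<le> b"
    by (auto simp: cube_eq[OF f] dest: spec[of _ i])
qed

lemma cube_mono:
  fixes f :: "real^'n \<Rightarrow> real^'n"
  assumes f: "orthogonal_transformation f" and "s \<le> t"
  shows "cube f c s \<subseteq> cube f c t"
  using \<open>s \<le> t\<close> unfolding cube_eq[OF f] by (auto intro: order_trans)

lemma borel_cube [measurable]:
  fixes f :: "real^'n \<Rightarrow> real^'n"
  assumes f: "orthogonal_transformation f"
  shows "cube f c a \<in> sets borel"
  unfolding cube_eq[OF f]
  by (intro borel_closed closed_Collect_all closed_Collect_conj closed_Collect_le continuous_intros)

text \<open>A level set of a coordinate is a hyperplane, hence null. Continuity of every cut below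
  rests on this.\<close>

lemma AE_coord_neq:
  fixes f :: "real^'n \<Rightarrow> real^'n"
  assumes f: "orthogonal_transformation f"
  shows "AE x in lborel. f (axis i 1) \<bullet> (x - c) \<noteq> t"
proof -
  have "f (axis i 1) \<bullet> f (axis i 1) = 1"
    using coord_image[OF f, of i "axis i 1"] by simp
  then have "f (axis i 1) \<noteq> 0" by auto
  then have "negligible {x. f (axis i 1) \<bullet> x = t + f (axis i 1) \<bullet> c}"
    by (intro negligible_hyperplane) simp
  moreover have "closed {x. f (axis i 1) \<bullet> x = t + f (axis i 1) \<bullet> c}"
    by (rule closed_hyperplane)
  ultimately have "{x. f (axis i 1) \<bullet> x = t + f (axis i 1) \<bullet> c} \<in> null_sets lborel"
    by (simp add: negligible_iff_null_sets null_sets_completion_iff borel_closed)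
  from AE_not_in[OF this] show ?thesis
    by eventually_elim (auto simp: inner_diff_right)
qed

section \<open>Additivity and continuity of value measures\<close>

lemma set_integrable_density:
  assumes "value_density C v" "A \<in> sets borel" "A \<subseteq> C"
  shows "set_integrable lborel A v"
  using assms set_integrable_subset[of lborel C v A] by (auto simp: value_density_def)

lemma VM_mono:
  assumes "value_density C v" "A \<in> sets borel" "B \<in> sets borel" "A \<subseteq> B" "B \<subseteq> C"
  shows "VM v A \<le> VM v B"
proof -
  have "set_integrable lborel A v" "set_integrable lborel B v"
    using set_integrable_density[OF assms(1)] assms by auto
  then show ?thesis
    unfolding VM_def set_lebesgue_integral_def set_integrable_def
    by (rule integral_mono) (use assms in \<open>auto simp: value_density_def indicator_def\<close>)
qed

lemma VM_nonneg:
  assumes "value_density C v"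
  shows "0 \<le> VM v A"
  unfolding VM_def set_lebesgue_integral_def
  using assms by (auto simp: value_density_def intro!: integral_nonneg)

lemma VM_Un:
  assumes "value_density C v" "A \<in> sets borel" "B \<in> sets borel" "A \<union> B \<subseteq> C" "A \<inter> B = {}"
  shows "VM v (A \<union> B) = VM v A + VM v B"
  unfolding VM_def
  using set_integral_Un[of A B lborel v] set_integrable_density[OF assms(1)] assms by auto

lemma VM_Diff:
  assumes "value_density C v" "A \<in> sets borel" "B \<in> sets borel" "A \<subseteq> C"
  shows "VM v (A - B) = VM v A - VM v (A \<inter> B)"
proof -
  have "VM v ((A - B) \<union> (A \<inter> B)) = VM v (A - B) + VM v (A \<inter> B)"
    using assms by (intro VM_Un[OF assms(1)]) auto
  moreover have "(A - B) \<union> (A \<inter> B) = A" by auto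
  ultimately show ?thesis by simp
qed

text \<open>Dominated convergence, with the density on \<open>C\<close> as majorant; it is enough
  that membership stabilises at almost every point.\<close>

lemma VM_tendsto:
  assumes v: "value_density C v" and A: "\<And>n. A n \<in> sets borel" "\<And>n. A n \<subseteq> C" "B \<in> sets borel" "B \<subseteq> C"
    and C: "C \<in> sets borel"
    and ae: "AE x in lborel. \<forall>\<^sub>F n in sequentially. x \<in> A n \<longleftrightarrow> x \<in> B"
  shows "(\<lambda>n. VM v (A n)) \<longlonglongrightarrow> VM v B"
  unfolding VM_def set_lebesgue_integral_def
proof (rule integral_dominated_convergence[where w="\<lambda>x. indicator C x *\<^sub>R v x"])
  have [measurable]: "v \<in> borel_measurable borel" using v by (simp add: value_density_def)
  note [measurable] = A
  show "(\<lambda>x. indicat_real B x *\<^sub>R v x) \<in> borel_measurable lborel" by measurable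
  show "(\<lambda>x. indicat_real (A n) x *\<^sub>R v x) \<in> borel_measurable lborel" for n by measurable
  show "integrable lborel (\<lambda>x. indicat_real C x *\<^sub>R v x)"
    using v by (simp add: value_density_def set_integrable_def)
  show "AE x in lborel. norm (indicat_real (A n) x *\<^sub>R v x) \<le> indicat_real C x *\<^sub>R v x" for n
    using v A(2)[of n] by (auto simp: value_density_def indicator_def)
  show "AE x in lborel. (\<lambda>n. indicat_real (A n) x *\<^sub>R v x) \<longlonglongrightarrow> indicat_real B x *\<^sub>R v x"
    using ae
  proof eventually_elim
    case (elim x)
    then have "\<forall>\<^sub>F n in sequentially. indicat_real (A n) x *\<^sub>R v x = indicat_real B x *\<^sub>R v x"
      by eventually_elim (auto simp: indicator_def)
    then show ?case by (rule tendsto_eventually)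
  qed
qed

text \<open>A point off the level set of \<open>t\<close> stays on its side for all parameters near
  \<open>t\<close>, and that level set is null, so dominated convergence along sequences
  applies.\<close>

lemma continuous_VM_sublevel:
  fixes \<phi> :: "real^'n \<Rightarrow> real"
  assumes v: "value_density C v" and C: "C \<in> sets borel" and D: "D \<in> sets borel" "D \<subseteq> C"
    and \<phi>: "\<phi> \<in> borel_measurable borel" "\<And>t. AE x in lborel. \<phi> x \<noteq> t"
  shows "continuous_on T (\<lambda>t. VM v (D \<inter> {x. \<phi> x \<le> t}))"
  unfolding continuous_on_sequentially
proof (clarify, unfold comp_def)
  fix u :: "nat \<Rightarrow> real" and t assume u: "u \<longlonglongrightarrow> t"
  have [measurable]: "\<phi> \<in> borel_measurable borel" "D \<in> sets borel" by fact+
  have S: "D \<inter> {x. \<phi> x \<le> s} \<in> sets borel" for s by measurable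
  show "(\<lambda>n. VM v (D \<inter> {x. \<phi> x \<le> u n})) \<longlonglongrightarrow> VM v (D \<inter> {x. \<phi> x \<le> t})"
  proof (rule VM_tendsto[OF v S _ S _ C])
    show "AE x in lborel. \<forall>\<^sub>F n in sequentially. x \<in> D \<inter> {x. \<phi> x \<le> u n} \<longleftrightarrow> x \<in> D \<inter> {x. \<phi> x \<le> t}"
      using \<phi>(2)[of t]
    proof eventually_elim
      case (elim x)
      then consider "\<phi> x < t" | "t < \<phi> x" by linarith
      then show ?case
      proof cases
        case 1
        from order_tendstoD(1)[OF u 1] show ?thesis
          by eventually_elim (use 1 in auto)
      next
        case 2
        from order_tendstoD(2)[OF u 2] show ?thesis
          by eventually_elim (use 2 in auto)
      qed
    qed
  qed (use D in auto)
qed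

section \<open>Balanced cuts into fat pieces, and exhaustion of \<open>C\<close>\<close>

text \<open>Intermediate value theorem in the side \<open>s\<close>, with the corner
  \<open>c\<close> fixed: a cube of side 0 is worthless while \<open>E\<close> is not, and at side
  \<open>q\<close> the cube outweighs the rest by assumption. The cube may stick out of
  \<open>E\<close>.\<close>

lemma shrink_cube:
  fixes f :: "real^'n \<Rightarrow> real^'n"
  assumes f: "orthogonal_transformation f" and v: "value_density C v" and C: "C \<in> sets borel"
    and Q: "cube f c q \<subseteq> C" and E: "E \<in> sets borel" "E \<subseteq> C"
    and pos: "0 < VM v E" and large: "VM v (E - cube f c q) \<le> VM v (cube f c q)" and "0 \<le> q"
  obtains s where "0 < s" "s \<le> q" "VM v (cube f c s) = VM v (E - cube f c s)"
proof -
  \<comment> \<open>The largest coordinate relative to \<open>c\<close>: inside \<open>Q\<close> its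
    sublevel sets are the cubes with corner \<open>c\<close>, so
    \<open>continuous_VM_sublevel\<close> covers the growing cube.\<close>
  define \<phi> where "\<phi> = (\<lambda>x. Max (range (\<lambda>i. f (axis i 1) \<bullet> (x - c))))"
  define Q where "Q = cube f c q"
  have \<phi>_le: "\<phi> x \<le> t \<longleftrightarrow> (\<forall>i. f (axis i 1) \<bullet> (x - c) \<le> t)" for x t
    unfolding \<phi>_def by (subst Max_le_iff) auto
  have cube_s: "Q \<inter> {x. \<phi> x \<le> s} = cube f c s" if "s \<le> q" for s
    using that unfolding Q_def cube_eq[OF f] \<phi>_le by (auto intro: order_trans)
  have meas[measurable]: "\<phi> \<in> borel_measurable borel"
  proof (rule borel_measurableI_le)
    fix t show "{x \<in> space borel. \<phi> x \<le> t} \<in> sets borel"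
      unfolding \<phi>_le by (auto intro!: borel_closed closed_Collect_all closed_Collect_le continuous_intros)
  qed
  have ae: "AE x in lborel. \<phi> x \<noteq> t" for t
  proof -
    have "AE x in lborel. \<forall>i. f (axis i 1) \<bullet> (x - c) \<noteq> t"
      using AE_coord_neq[OF f] by (simp add: AE_all_countable)
    then show ?thesis
    proof eventually_elim
      case (elim x)
      have "\<phi> x \<in> range (\<lambda>i. f (axis i 1) \<bullet> (x - c))"
        unfolding \<phi>_def by (rule Max_in) auto
      then show ?case using elim by auto
    qed
  qed
  have Qm[measurable]: "Q \<in> sets borel" "E \<in> sets borel" using f E by (auto simp: Q_def)
  \<comment> \<open>The value of the complement is expanded by additivity, so that apart from
    constants only sublevel sets occur.\<close>
  define g where "g = (\<lambda>s. VM v (Q \<inter> {x. \<phi> x \<le> s}) - (VM v E - VM v ((E \<inter> Q) \<inter> {x. \<phi> x \<le> s})))"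
  have g_eq: "g s = VM v (cube f c s) - VM v (E - cube f c s)" if "s \<le> q" for s
    using VM_Diff[OF v E(1) borel_cube[OF f] E(2), of c s] cube_s[OF that]
    by (simp add: g_def Int_assoc)
  \<comment> \<open>Such a cube is empty or the single point \<open>c\<close>, which lies in the
    null set where \<open>\<phi>\<close> vanishes.\<close>
  have null: "VM v (cube f c s) = 0" if "s \<le> 0" for s
  proof -
    have "AE x in lborel. indicator (cube f c s) x *\<^sub>R v x = 0"
      using ae[of 0]
    proof eventually_elim
      case (elim x)
      have "\<phi> x = 0" if x: "x \<in> cube f c s"
      proof -
        have "f (axis i 1) \<bullet> (x - c) = 0" for i
          using x \<open>s \<le> 0\<close> unfolding cube_eq[OF f] mem_Collect_eq by (meson order_antisym order_trans)
        then show ?thesis by (simp add: \<phi>_def)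
      qed
      then show ?case using elim by (auto simp: indicator_def)
    qed
    then show ?thesis unfolding VM_def set_lebesgue_integral_def by (rule integral_eq_zero_AE)
  qed
  \<comment> \<open>Strictness excludes a root at \<open>s = 0\<close>, so the balancing cube has
    positive side.\<close>
  have neg: "g s < 0" if "s \<le> 0" for s
  proof -
    have "VM v (E - cube f c s) = VM v E - VM v (E \<inter> cube f c s)"
      using VM_Diff[OF v E(1) borel_cube[OF f] E(2)] .
    moreover have "VM v (E \<inter> cube f c s) \<le> VM v (cube f c s)"
      using cube_s[of s] that \<open>0 \<le> q\<close> Q f E by (intro VM_mono[OF v]) (auto simp: Q_def)
    ultimately show ?thesis using null[OF that] g_eq[of s] that \<open>0 \<le> q\<close> pos by simp
  qed
  have "\<exists>s\<ge>0. s \<le> q \<and> g s = 0"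
  proof (rule IVT')
    show "g 0 \<le> 0" using neg[of 0] by simp
    show "0 \<le> g q" using large g_eq[of q] by simp
    show "continuous_on {0..q} g" unfolding g_def
      using Q E by (intro continuous_intros continuous_VM_sublevel[OF v C] meas ae) (auto simp: Q_def f)
  qed fact
  then obtain s where "0 \<le> s" "s \<le> q" "g s = 0" by blast
  moreover have "0 < s" using neg[of s] \<open>g s = 0\<close> by (cases "s \<le> 0") auto
  ultimately show ?thesis using g_eq[of s] that[of s] by simp
qed

text \<open>The first piece is \<open>P\<close> with the part of \<open>E\<close> behind a moving
  hyperplane, the second is \<open>Q\<close> with the part of \<open>F\<close> ahead of it. The pair
  starts as \<open>P\<close>, \<open>F - P\<close> and ends as \<open>E - Q\<close>,
  \<open>Q\<close>, so the two inequalities give opposite signs at the ends. Points of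
  \<open>E \<inter> F\<close> are always on one side and never lost.\<close>

lemma sweep_cut:
  fixes C :: "(real^'n) set"
  assumes v: "value_density C v" and C: "C \<in> sets borel" "bounded C"
    and P: "P \<in> sets borel" "P \<subseteq> E" and Q: "Q \<in> sets borel" "Q \<subseteq> F" and PQ: "P \<inter> Q = {}"
    and E: "E \<in> sets borel" "E \<subseteq> C" and F: "F \<in> sets borel" "F \<subseteq> C"
    and le: "VM v P \<le> VM v (F - P)" "VM v Q \<le> VM v (E - Q)"
  obtains X Y where "X \<in> sets borel" "Y \<in> sets borel" "X \<inter> Y = {}" "P \<subseteq> X" "X \<subseteq> E" "Q \<subseteq> Y" "Y \<subseteq> F"
    "E \<inter> F \<subseteq> X \<union> Y" "VM v X = VM v Y"
proof -
  \<comment> \<open>Any coordinate direction serves, whatever the orientation of the cubes: fatness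
    will come from the inclusions between \<open>P\<close> and \<open>E\<close>, and between
    \<open>Q\<close> and \<open>F\<close>, not from the shape of the cut.\<close>
  define k :: 'n where "k = undefined"
  define \<phi> :: "real^'n \<Rightarrow> real" where "\<phi> = (\<lambda>x. x $ k)"
  have meas[measurable]: "\<phi> \<in> borel_measurable borel" unfolding \<phi>_def by measurable
  have ae: "AE x in lborel. \<phi> x \<noteq> t" for t
    using AE_coord_neq[of id k 0 t] by (simp add: \<phi>_def orthogonal_transformation_id id_def inner_axis')
  obtain B where B: "\<And>x. x \<in> C \<Longrightarrow> norm x \<le> B" using C(2) by (auto simp: bounded_iff)
  \<comment> \<open>The added 1 puts \<open>C\<close> strictly between the two end positions of the
    hyperplane.\<close>
  define b where "b = max B 0 + 1"
  have range: "- b < \<phi> x" "\<phi> x < b" if "x \<in> C" for x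
    using B[OF that] component_le_norm_cart[of x k] by (auto simp: \<phi>_def b_def)
  note [measurable] = P(1) Q(1) E(1) F(1)
  define H where "H = (\<lambda>t. {x. \<phi> x \<le> t})"
  have [measurable]: "H t \<in> sets borel" for t unfolding H_def by measurable
  define X where "X = (\<lambda>t. (E - P - Q) \<inter> H t \<union> P)"
  define Y where "Y = (\<lambda>t. (F - P - Q - H t) \<union> Q)"
  define g where "g = (\<lambda>t. VM v ((E - P - Q) \<inter> {x. \<phi> x \<le> t}) + VM v P
    - (VM v (F - P - Q) - VM v ((F - P - Q) \<inter> {x. \<phi> x \<le> t}) + VM v Q))"
  have g_eq: "g t = VM v (X t) - VM v (Y t)" for t
  proof -
    have "VM v (X t) = VM v ((E - P - Q) \<inter> H t) + VM v P"
      unfolding X_def using P E by (intro VM_Un[OF v]) auto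
    moreover have "VM v (Y t) = VM v (F - P - Q - H t) + VM v Q"
      unfolding Y_def using Q F by (intro VM_Un[OF v]) auto
    moreover have "VM v (F - P - Q - H t) = VM v (F - P - Q) - VM v ((F - P - Q) \<inter> H t)"
      using F by (intro VM_Diff[OF v]) auto
    ultimately show ?thesis by (simp add: g_def H_def)
  qed
  have "\<exists>t\<ge>-b. t \<le> b \<and> g t = 0"
  proof (rule IVT')
    have "H (-b) \<inter> C = {}" using range by (fastforce simp: H_def)
    then have "X (-b) = P" "Y (-b) = F - P"
      using P Q PQ E F by (auto simp: X_def Y_def)
    then show "g (-b) \<le> 0" using le by (simp add: g_eq)
    have "C \<subseteq> H b" using range by (fastforce simp: H_def)
    then have "X b = E - Q" "Y b = Q"
      using P Q PQ E F by (auto simp: X_def Y_def)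
    then show "0 \<le> g b" using le by (simp add: g_eq)
    show "continuous_on {-b..b} g" unfolding g_def
      using E F by (intro continuous_intros continuous_VM_sublevel[OF v C(1)] meas ae) auto
    show "- b \<le> b" by (simp add: b_def)
  qed
  then obtain t where "g t = 0" by blast
  show thesis
  proof (rule that)
    show "X t \<in> sets borel" "Y t \<in> sets borel" unfolding X_def Y_def by measurable
    show "VM v (X t) = VM v (Y t)" using \<open>g t = 0\<close> g_eq by simp
  qed (use P Q PQ E F in \<open>auto simp: X_def Y_def\<close>)
qed

lemma fat_between_cubes:
  assumes "orthogonal_transformation f" "0 < a" "0 < b" "b / a \<le> R" "cube f c a \<subseteq> X" "X \<subseteq> cube f c' b"
  shows "fat R X"
  using assms unfolding fat_def by blast

text \<open>With \<open>E\<close> and \<open>F\<close> the parts of \<open>C\<close> in the two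
  bounding cubes, each piece is either a cube itself or trapped between a cube of side
  \<open>q\<close> and one of side \<open>\<beta>\<close>. In the shrinking cases the complement
  keeps the opposite inner cube because \<open>s \<le> q\<close> and the inner cubes are
  disjoint.\<close>

lemma fat_cut:
  fixes C :: "(real^'n) set"
  assumes v: "value_density C v" and C: "C \<in> sets borel" "bounded C" and "R \<ge> 1"
    and f: "orthogonal_transformation f" and pos: "0 < q" "0 < \<beta>" "\<beta> / q \<le> R"
    and P: "cube f c q \<subseteq> C \<inter> cube f c' \<beta>" and Q: "cube f d q \<subseteq> C \<inter> cube f d' \<beta>"
    and PQ: "cube f c q \<inter> cube f d q = {}"
    and K: "0 < VM v (C \<inter> cube f c' \<beta> \<inter> cube f d' \<beta>)"
  obtains X Y where "X \<in> sets borel" "Y \<in> sets borel" "fat R X" "fat R Y" "X \<inter> Y = {}" "X \<union> Y \<subseteq> C"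
    "C \<inter> cube f c' \<beta> \<inter> cube f d' \<beta> \<subseteq> X \<union> Y" "VM v X = VM v Y"
proof -
  note m = borel_cube[OF f]
  let ?E = "C \<inter> cube f c' \<beta>" let ?F = "C \<inter> cube f d' \<beta>"
  have EF: "?E \<in> sets borel" "?F \<in> sets borel" "?E \<subseteq> C" "?F \<subseteq> C" using C m by auto
  \<comment> \<open>Positive values of \<open>E\<close> and \<open>F\<close> let
    \<open>shrink_cube\<close> return a positive side; a degenerate cube would not be fat.\<close>
  have "0 < VM v ?E"
    by (rule less_le_trans[OF K VM_mono[OF v]]) (use C m in auto)
  have "0 < VM v ?F"
    by (rule less_le_trans[OF K VM_mono[OF v]]) (use C m in auto)
  have fat_cube: "fat R (cube f z s)" if "0 < s" for s z
    using that \<open>R \<ge> 1\<close> by (intro fat_between_cubes[OF f, of s s _ z _ z]) auto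
  consider "VM v (?F - cube f c q) \<le> VM v (cube f c q)"
    | "VM v (?E - cube f d q) \<le> VM v (cube f d q)"
    | "VM v (cube f c q) \<le> VM v (?F - cube f c q)" "VM v (cube f d q) \<le> VM v (?E - cube f d q)"
    by linarith
  then show thesis
  proof cases
    case 1
    obtain s where s: "0 < s" "s \<le> q" "VM v (cube f c s) = VM v (?F - cube f c s)"
      using shrink_cube[OF f v C(1) _ EF(2,4) \<open>0 < VM v ?F\<close> 1] P pos by auto
    show thesis
    proof (rule that[of "cube f c s" "?F - cube f c s"])
      show "fat R (?F - cube f c s)"
        using Q PQ cube_mono[OF f s(2), of c] by (intro fat_between_cubes[OF f pos]) auto
    qed (use s P EF m cube_mono[OF f s(2), of c] fat_cube in auto)
  next
    case 2
    obtain s where s: "0 < s" "s \<le> q" "VM v (cube f d s) = VM v (?E - cube f d s)"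
      using shrink_cube[OF f v C(1) _ EF(1,3) \<open>0 < VM v ?E\<close> 2] Q pos by auto
    show thesis
    proof (rule that[of "cube f d s" "?E - cube f d s"])
      show "fat R (?E - cube f d s)"
        using P PQ cube_mono[OF f s(2), of d] by (intro fat_between_cubes[OF f pos]) auto
    qed (use s Q EF m cube_mono[OF f s(2), of d] fat_cube in auto)
  next
    case 3
    obtain X Y where XY: "X \<in> sets borel" "Y \<in> sets borel" "X \<inter> Y = {}" "cube f c q \<subseteq> X" "X \<subseteq> ?E"
      "cube f d q \<subseteq> Y" "Y \<subseteq> ?F" "?E \<inter> ?F \<subseteq> X \<union> Y" "VM v X = VM v Y"
      using sweep_cut[OF v C m P m Q PQ EF(1,3) EF(2,4) 3] by blast
    show thesis
    proof (rule that[of X Y])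
      show "fat R X" "fat R Y"
        using XY by (auto intro: fat_between_cubes[OF f pos])
    qed (use XY in auto)
  qed
qed

text \<open>Two closed parallel cubes of half the side of \<open>B\<^sup>-\<close> inside \<open>B\<^sup>-\<close> always meet, so a balanced
  cut into \<open>2 R\<close>-fat pieces need not be able to exhaust \<open>C\<close>. Shrinking the two inner cubes and the
  two bounding cubes by the same factor separates the former while leaving the ratio \<open>2 R\<close> intact;
  only the part of \<open>C\<close> close to the boundary of \<open>B\<^sup>+\<close> is lost.\<close>
lemma fat_exhaustion:
  fixes C :: "(real^'n) set"
  assumes C: "C \<in> sets borel" "bounded C" and "R \<ge> 1" and "fat R C"
  obtains K :: "nat \<Rightarrow> (real^'n) set" where "\<forall>n. K n \<in> sets borel \<and> K n \<subseteq> C"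
    "AE x in lborel. \<forall>\<^sub>F n in sequentially. x \<in> K n \<longleftrightarrow> x \<in> C"
    "\<forall>n v. value_density C v \<longrightarrow> 0 < VM v (K n) \<longrightarrow> (\<exists>X Y. X \<in> sets borel \<and> Y \<in> sets borel \<and>
       fat (2 * R) X \<and> fat (2 * R) Y \<and> X \<inter> Y = {} \<and> X \<union> Y \<subseteq> C \<and> K n \<subseteq> X \<union> Y \<and> VM v X = VM v Y)"
proof -
  from \<open>fat R C\<close> obtain f c a c' b where f: "orthogonal_transformation f" and ab: "0 < a" "0 < b" "b / a \<le> R"
    and sub: "cube f c a \<subseteq> C" "C \<subseteq> cube f c' b" unfolding fat_def by blast
  note m = borel_cube[OF f]
  have "cube f c a \<subseteq> cube f c' b" using sub by blast
  note corner = cube_subset_corner[OF f less_imp_le[OF ab(1)] this]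
  have "a \<le> b" using corner[of undefined] by linarith
  \<comment> \<open>The factor \<open>a / (2 * b)\<close> keeps the loss
    \<open>\<delta> n * b\<close> in the outer side at most \<open>a / 2\<close>, which the
    placement of both inner cubes requires.\<close>
  define \<delta> where "\<delta> = (\<lambda>n::nat. a / (2 * b) * inverse (real (Suc n)))"
  have \<delta>: "0 < \<delta> n" "\<delta> n * b \<le> a / 2" "\<delta> n < 1" for n
  proof -
    show "0 < \<delta> n" using ab by (simp add: \<delta>_def)
    have "\<delta> n \<le> a / (2 * b) * 1" unfolding \<delta>_def
      using ab by (intro mult_left_mono) (auto simp: divide_simps)
    moreover have "a / (2 * b) < 1" using ab \<open>a \<le> b\<close> by (simp add: divide_simps)
    ultimately show "\<delta> n < 1" by linarith
    show "\<delta> n * b \<le> a / 2"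
      using mult_right_mono[OF \<open>\<delta> n \<le> a / (2 * b) * 1\<close>, of b] ab by simp
  qed
  have lim: "\<delta> \<longlonglongrightarrow> 0"
    unfolding \<delta>_def by (rule tendsto_mult_right_zero[OF LIMSEQ_inverse_real_of_nat])
  \<comment> \<open>The common factor \<open>1 - \<delta> n\<close> cancels in
    \<open>\<beta> n / q n\<close>, leaving \<open>2 * (b / a)\<close>. The points
    \<open>d n\<close> and \<open>d' n\<close> place the second inner and outer cubes at the corners
    opposite to \<open>c\<close> and \<open>c'\<close>.\<close>
  define q where "q = (\<lambda>n. (1 - \<delta> n) * a / 2)"
  define \<beta> where "\<beta> = (\<lambda>n. (1 - \<delta> n) * b)"
  define d where "d = (\<lambda>n. c + f (\<chi> j. a - q n))"
  define d' where "d' = (\<lambda>n. c' + f (\<chi> j. b - \<beta> n))"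
  define K where "K = (\<lambda>n. C \<inter> cube f c' (\<beta> n) \<inter> cube f (d' n) (\<beta> n))"
  have q: "0 < q n" "0 < \<beta> n" "\<beta> n / q n \<le> 2 * R" "q n < a / 2" for n
  proof -
    show "0 < q n" "0 < \<beta> n" "q n < a / 2"
      using \<delta>[of n] ab by (simp_all add: q_def \<beta>_def field_simps)
    have "\<beta> n / q n = 2 * (b / a)" using \<delta>(3)[of n] by (simp add: q_def \<beta>_def)
    then show "\<beta> n / q n \<le> 2 * R" using ab by simp
  qed
  have split: "f (axis i 1) \<bullet> (x - c') = f (axis i 1) \<bullet> (x - c) + f (axis i 1) \<bullet> (c - c')" for i x
    by (simp add: inner_diff_right)
  have P: "cube f c (q n) \<subseteq> C \<inter> cube f c' (\<beta> n)" for n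
  proof -
    have "cube f c (q n) \<subseteq> cube f c a"
      using q(4)[of n] ab by (intro cube_mono[OF f]) simp
    \<comment> \<open>Since \<open>c\<close> is offset from \<open>c'\<close> by at most
      \<open>b - a\<close> in each coordinate, this bound keeps the inner cube inside the trimmed
      one.\<close>
    moreover have "b - a + q n \<le> \<beta> n"
    proof -
      have "0 \<le> \<delta> n * a" using \<delta>[of n] ab by simp
      then show ?thesis using \<delta>(2)[of n] by (simp add: q_def \<beta>_def field_simps)
    qed
    have "cube f c (q n) \<subseteq> cube f c' (\<beta> n)"
      unfolding cube_eq[OF f]
    proof (safe)
      fix x i assume x: "\<forall>i. 0 \<le> f (axis i 1) \<bullet> (x - c) \<and> f (axis i 1) \<bullet> (x - c) \<le> q n"
      show "0 \<le> f (axis i 1) \<bullet> (x - c')" "f (axis i 1) \<bullet> (x - c') \<le> \<beta> n"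
        using x[rule_format, of i] corner[of i] split[of i x] \<open>b - a + q n \<le> \<beta> n\<close> by linarith+
    qed
    ultimately show ?thesis using sub by blast
  qed
  have Q: "cube f (d n) (q n) \<subseteq> C \<inter> cube f (d' n) (\<beta> n)" for n
  proof -
    have "0 \<le> y \<and> y \<le> a" if "a - q n \<le> y \<and> y \<le> a - q n + q n" for y
      using that q(4)[of n] ab by linarith
    then have "cube f (d n) (q n) \<subseteq> cube f c a"
      unfolding d_def cube_shift_eq[OF f] unfolding cube_eq[OF f] by blast
    moreover have "b - \<beta> n \<le> a - q n"
      using \<delta>(2)[of n] q(4)[of n] by (simp add: \<beta>_def algebra_simps)
    have "cube f (d n) (q n) \<subseteq> cube f (d' n) (\<beta> n)"
      unfolding d_def d'_def cube_shift_eq[OF f]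
    proof (safe)
      fix x i assume x: "\<forall>i. a - q n \<le> f (axis i 1) \<bullet> (x - c) \<and> f (axis i 1) \<bullet> (x - c) \<le> a - q n + q n"
      show "b - \<beta> n \<le> f (axis i 1) \<bullet> (x - c')" "f (axis i 1) \<bullet> (x - c') \<le> b - \<beta> n + \<beta> n"
        using x[rule_format, of i] corner[of i] split[of i x] \<open>b - \<beta> n \<le> a - q n\<close> by linarith+
    qed
    ultimately show ?thesis using sub by blast
  qed
  have PQ: "cube f c (q n) \<inter> cube f (d n) (q n) = {}" for n
  proof -
    have "\<not> (a - q n \<le> y \<and> y \<le> q n)" for y using q(4)[of n] by linarith
    then show ?thesis unfolding d_def cube_shift_eq[OF f] unfolding cube_eq[OF f] by blast
  qed
  \<comment> \<open>Off the boundary hyperplanes of the outer cube, all coordinates of a point of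
    \<open>C\<close> are strictly between 0 and \<open>b\<close>, hence between
    \<open>b - \<beta> n\<close> and \<open>\<beta> n\<close> once \<open>\<beta> n\<close> is close
    to \<open>b\<close>.\<close>
  have "AE x in lborel. \<forall>i. f (axis i 1) \<bullet> (x - c') \<noteq> 0 \<and> f (axis i 1) \<bullet> (x - c') \<noteq> b"
    using AE_coord_neq[OF f] by (simp add: AE_all_countable)
  then have ae: "AE x in lborel. \<forall>\<^sub>F n in sequentially. x \<in> K n \<longleftrightarrow> x \<in> C"
  proof eventually_elim
    case (elim x)
    show ?case
    proof (cases "x \<in> C")
      case True
      have "\<forall>\<^sub>F n in sequentially. b - \<beta> n \<le> f (axis i 1) \<bullet> (x - c') \<and> f (axis i 1) \<bullet> (x - c') \<le> \<beta> n" for i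
      proof -
        have y: "0 < f (axis i 1) \<bullet> (x - c')" "f (axis i 1) \<bullet> (x - c') < b"
          using True sub(2) elim[rule_format, of i] unfolding cube_eq[OF f] by (auto simp: less_le)
        have "\<beta> \<longlonglongrightarrow> (1 - 0) * b" unfolding \<beta>_def by (intro tendsto_intros lim)
        then have "\<beta> \<longlonglongrightarrow> b" "(\<lambda>n. b - \<beta> n) \<longlonglongrightarrow> 0" by (auto intro!: tendsto_eq_intros)
        from eventually_conj[OF order_tendstoD(1)[OF this(1) y(2)] order_tendstoD(2)[OF this(2) y(1)]]
        show ?thesis by eventually_elim simp
      qed
      then have "\<forall>\<^sub>F n in sequentially. \<forall>i. b - \<beta> n \<le> f (axis i 1) \<bullet> (x - c') \<and> f (axis i 1) \<bullet> (x - c') \<le> \<beta> n"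
        by (intro eventually_all_finite)
      then show ?thesis
      proof eventually_elim
        case (elim n)
        have "\<beta> n \<le> b" using \<delta>(1)[of n] ab by (simp add: \<beta>_def algebra_simps)
        then have "0 \<le> y \<and> y \<le> \<beta> n \<and> y \<le> b - \<beta> n + \<beta> n" if "b - \<beta> n \<le> y \<and> y \<le> \<beta> n" for y
          using that by linarith
        then show ?case
          using elim True unfolding K_def d'_def cube_shift_eq[OF f] unfolding cube_eq[OF f] by simp
      qed
    next
      case False
      then show ?thesis by (simp add: K_def)
    qed
  qed
  show thesis
  proof (rule that[OF _ ae], safe)
    show "K n \<in> sets borel" "x \<in> K n \<Longrightarrow> x \<in> C" for n x using C m by (auto simp: K_def)
    fix n v assume v: "value_density C v" and "0 < VM v (K n)"
    then have pos: "0 < VM v (C \<inter> cube f c' (\<beta> n) \<inter> cube f (d' n) (\<beta> n))" by (simp add: K_def)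
    have "1 \<le> 2 * R" using \<open>R \<ge> 1\<close> by simp
    obtain X Y where "X \<in> sets borel" "Y \<in> sets borel" "fat (2 * R) X" "fat (2 * R) Y" "X \<inter> Y = {}"
      "X \<union> Y \<subseteq> C" "C \<inter> cube f c' (\<beta> n) \<inter> cube f (d' n) (\<beta> n) \<subseteq> X \<union> Y" "VM v X = VM v Y"
      by (rule fat_cut[OF v C \<open>1 \<le> 2 * R\<close> f q(1-3)[of n] P[of n] Q[of n] PQ pos])
    then show "\<exists>X Y. X \<in> sets borel \<and> Y \<in> sets borel \<and>
       fat (2 * R) X \<and> fat (2 * R) Y \<and> X \<inter> Y = {} \<and> X \<union> Y \<subseteq> C \<and> K n \<subseteq> X \<union> Y \<and> VM v X = VM v Y"
      unfolding K_def by (intro exI[of _ X] exI[of _ Y] conjI)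
  qed
qed

section \<open>Envy-free allocations of value close to one half\<close>

text \<open>By monotonicity the supremum is attained at the piece itself, so for allocated pieces
  envy-freeness compares plain values.\<close>

lemma VS_self:
  assumes v: "value_density C v" and S: "S \<subseteq> sets borel" and X: "X \<in> S" "X \<subseteq> C"
  shows "VS S v X = VM v X"
  unfolding VS_def
  using assms by (intro cSup_eq_maximum) (auto intro!: VM_mono[OF v])

text \<open>Boundedness makes the volume of \<open>C\<close> finite; the nonempty open interior of
  the inner cube makes it positive.\<close>

lemma value_density_1:
  fixes C :: "(real^'n) set"
  assumes C: "C \<in> sets borel" "bounded C" and "fat R C"
  shows "value_density C (\<lambda>x. 1)"
proof -
  have fin: "emeasure lborel C < \<infinity>"
    using C(2) by (rule emeasure_bounded_finite)
  from \<open>fat R C\<close> obtain f c a where f: "orthogonal_transformation f" and a: "0 < a" "cube f c a \<subseteq> C"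
    unfolding fat_def by blast
  let ?U = "\<Inter>i. {x. 0 < f (axis i 1) \<bullet> (x - c) \<and> f (axis i 1) \<bullet> (x - c) < a}"
  have U: "open ?U"
    by (intro open_INT ballI finite open_Collect_conj open_Collect_less continuous_intros)
  have "c + f (\<chi> j. a / 2) \<in> ?U" using a coord_image[OF f] by simp
  then have "?U \<noteq> {}" by blast
  then have "?U \<notin> null_sets lborel"
    using U open_not_negligible[OF U] by (simp add: negligible_iff_null_sets null_sets_completion_iff borel_open)
  then have "0 < emeasure lborel ?U" using U by (auto simp: null_sets_def zero_less_iff_neq_zero)
  also have "\<dots> \<le> emeasure lborel C"
    using C a by (intro emeasure_mono) (auto simp: cube_eq[OF f] less_imp_le subset_iff)
  finally have "0 < measure lborel C"
    using fin by (simp add: measure_def enn2real_positive_iff)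
  then show ?thesis
    using C fin by (auto simp: value_density_def VM_def set_integrable_def set_lebesgue_integral_def)
qed

lemma Min_image_lessThan_2: "Min ((g :: nat \<Rightarrow> real) ` {..<2}) = min (g 0) (g 1)"
proof -
  have "{..<2::nat} = {0, 1}" by auto
  then show ?thesis by simp
qed

lemma allocation_2:
  "allocation C 2 S X \<longleftrightarrow> X 0 \<in> S \<and> X 1 \<in> S \<and> X 0 \<inter> X 1 = {} \<and> X 0 \<union> X 1 \<subseteq> C"
proof -
  have "{..<2::nat} = {0, 1}" by auto
  then show ?thesis unfolding allocation_def by (auto simp: less_2_cases_iff all_conj_distrib)
qed

text \<open>For large \<open>n\<close> the set \<open>K n\<close> carries almost all the value of
  both agents. The balanced cut for agent 0 covers \<open>K n\<close>, so the better of the two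
  pieces is worth nearly half to either agent.\<close>

lemma envy_free_near_half:
  fixes C :: "(real^'n) set" and R :: real
  defines "S \<equiv> {X \<in> sets borel. fat (2 * R) X}"
  assumes C: "C \<in> sets borel" "bounded C" and "R \<ge> 1" and "fat R C"
    and v: "\<forall>i<2. value_density C (v i)" and "\<epsilon> > 0"
  obtains X where "allocation C 2 S X" "envy_free 2 S v X"
    "1 / 2 - \<epsilon> \<le> Min ((\<lambda>i. VM (v i) (X i) / VM (v i) C) ` {..<2})"
proof -
  have v0: "value_density C (v 0)" and v1: "value_density C (v 1)" using v by auto
  have S: "S \<subseteq> sets borel" by (auto simp: S_def)
  obtain K where K: "\<forall>n. K n \<in> sets borel \<and> K n \<subseteq> C"
    and ae: "AE x in lborel. \<forall>\<^sub>F n in sequentially. x \<in> K n \<longleftrightarrow> x \<in> C"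
    and cut: "\<forall>n v. value_density C v \<longrightarrow> 0 < VM v (K n) \<longrightarrow> (\<exists>X Y. X \<in> sets borel \<and> Y \<in> sets borel \<and>
       fat (2 * R) X \<and> fat (2 * R) Y \<and> X \<inter> Y = {} \<and> X \<union> Y \<subseteq> C \<and> K n \<subseteq> X \<union> Y \<and> VM v X = VM v Y)"
    by (rule fat_exhaustion[OF C \<open>R \<ge> 1\<close> \<open>fat R C\<close>])
  from K have K: "K n \<in> sets borel" "K n \<subseteq> C" for n by auto
  \<comment> \<open>The \<open>max 0\<close> matters for large \<open>\<epsilon>\<close>: the bound
    then still forces \<open>K n\<close> to have positive value, as the cut demands.\<close>
  have ev: "\<forall>\<^sub>F n in sequentially. max 0 (1 - 2 * \<epsilon>) * VM w C < VM w (K n)" if w: "value_density C w" for w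
  proof -
    have "(\<lambda>n. VM w (K n)) \<longlonglongrightarrow> VM w C"
      by (rule VM_tendsto[OF w K C(1) _ C(1) ae]) simp
    moreover have "0 < VM w C" using w by (simp add: value_density_def)
    then have "max 0 (1 - 2 * \<epsilon>) * VM w C < 1 * VM w C"
      using \<open>\<epsilon> > 0\<close> by (intro mult_strict_right_mono) auto
    ultimately show ?thesis by (intro order_tendstoD) auto
  qed
  obtain n where n: "max 0 (1 - 2 * \<epsilon>) * VM (v 0) C < VM (v 0) (K n)"
      "max 0 (1 - 2 * \<epsilon>) * VM (v 1) C < VM (v 1) (K n)"
    using eventually_happens[OF eventually_conj[OF ev[OF v0] ev[OF v1]]] by auto
  have "0 < VM (v 0) (K n)" using n(1) VM_nonneg[OF v0, of C] by (smt (verit) mult_nonneg_nonneg)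
  then obtain A B where "A \<in> sets borel" "B \<in> sets borel" "fat (2 * R) A" "fat (2 * R) B"
      and AB': "A \<inter> B = {}" "A \<union> B \<subseteq> C" "K n \<subseteq> A \<union> B" and eq: "VM (v 0) A = VM (v 0) B"
    using cut[rule_format, OF v0] by metis
  then have AB: "A \<in> S" "B \<in> S" "A \<inter> B = {}" "A \<union> B \<subseteq> C" "K n \<subseteq> A \<union> B"
    by (auto simp: S_def)
  \<comment> \<open>Agent 1 receives the piece he prefers, \<open>A\<close> in case of a tie; agent
    0 is indifferent.\<close>
  define X where "X = (\<lambda>i::nat. if (i = 0) = (VM (v 1) B \<le> VM (v 1) A) then B else A)"
  have X01: "X 0 = A \<and> X 1 = B \<or> X 0 = B \<and> X 1 = A" by (auto simp: X_def)
  have alloc: "allocation C 2 S X"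
    unfolding allocation_2 using AB X01 by auto
  have pref: "VM (v 0) (X 0) = VM (v 0) (X 1)" "VM (v 1) (X 0) \<le> VM (v 1) (X 1)"
    using eq by (auto simp: X_def)
  have XS: "X 0 \<in> S" "X 1 \<in> S" "X 0 \<subseteq> C" "X 1 \<subseteq> C" using alloc by (auto simp: allocation_2)
  have ef: "envy_free 2 S v X"
    unfolding envy_free_def
    using pref VS_self[OF v0 S] VS_self[OF v1 S] XS by (auto simp: less_2_cases_iff)
  have sum: "VM w (K n) \<le> VM w (X 0) + VM w (X 1)" if w: "value_density C w" for w
  proof -
    have "VM w (K n) \<le> VM w (A \<union> B)"
      using AB S K by (intro VM_mono[OF w]) auto
    also have "\<dots> = VM w A + VM w B"
      using AB S by (intro VM_Un[OF w]) auto
    finally show ?thesis using X01 by auto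
  qed
  have half: "1 / 2 - \<epsilon> \<le> VM w (X i) / VM w C"
    if w: "value_density C w" "max 0 (1 - 2 * \<epsilon>) * VM w C < VM w (K n)"
      "VM w (X 0) + VM w (X 1) \<le> 2 * VM w (X i)" for w i
  proof -
    have pos: "0 < VM w C" using w(1) by (simp add: value_density_def)
    have "(1 - 2 * \<epsilon>) * VM w C \<le> max 0 (1 - 2 * \<epsilon>) * VM w C"
      using pos by (intro mult_right_mono) auto
    then have "(1 - 2 * \<epsilon>) * VM w C \<le> 2 * VM w (X i)"
      using sum[OF w(1)] w by linarith
    then have "(1 / 2 - \<epsilon>) * VM w C \<le> VM w (X i)" by (simp add: algebra_simps)
    then show ?thesis using pos by (simp add: pos_le_divide_eq)
  qed
  show thesis
  proof (rule that[OF alloc ef])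
    show "1 / 2 - \<epsilon> \<le> Min ((\<lambda>i. VM (v i) (X i) / VM (v i) C) ` {..<2})"
      unfolding Min_image_lessThan_2
      using half[OF v0 n(1), of 0] half[OF v1 n(2), of 1] pref by simp
  qed
qed

section \<open>The upper bound and the values of the two infima\<close>

lemma Min_value_le_1:
  assumes S: "S \<subseteq> sets borel" and C: "C \<in> sets borel" and v: "\<forall>i<2. value_density C (v i)"
    and X: "allocation C 2 S X"
  shows "Min ((\<lambda>i. VM (v i) (X i) / VM (v i) C) ` {..<2}) \<le> 1"
proof -
  have v0: "value_density C (v 0)" using v by auto
  have "VM (v 0) (X 0) \<le> VM (v 0) C"
    using X S C by (intro VM_mono[OF v0]) (auto simp: allocation_2)
  then have "VM (v 0) (X 0) / VM (v 0) C \<le> 1"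
    using v0 by (simp add: value_density_def)
  then show ?thesis unfolding Min_image_lessThan_2 by linarith
qed

text \<open>Two disjoint pieces have total relative value at most 1 under a common measure, so the
  smaller share is at most one half.\<close>

lemma Min_value_equal_agents:
  assumes S: "S \<subseteq> sets borel" and C: "C \<in> sets borel" and v: "value_density C v"
    and X: "allocation C 2 S X"
  shows "Min ((\<lambda>i. VM v (X i) / VM v C) ` {..<2}) \<le> 1 / 2"
proof -
  have pos: "0 < VM v C" using v by (simp add: value_density_def)
  have "VM v (X 0) + VM v (X 1) = VM v (X 0 \<union> X 1)"
    using X S by (intro VM_Un[OF v, symmetric]) (auto simp: allocation_2)
  also have "\<dots> \<le> VM v C"
    using X S C by (intro VM_mono[OF v]) (auto simp: allocation_2)
  finally have "VM v (X 0) / VM v C + VM v (X 1) / VM v C \<le> 1"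
    using pos by (simp add: add_divide_distrib[symmetric])
  then show ?thesis unfolding Min_image_lessThan_2 by linarith
qed

text \<open>The predicate \<open>\<Phi>\<close> treats both quantities at once: it is envy-freeness
  for \<open>PropEF\<close> and always true for \<open>Prop\<close>. Admitting all envy-free
  allocations gives the lower bound, and the upper bound holds for every allocation.\<close>

lemma Inf_Sup_half:
  fixes C :: "(real^'n) set" and R :: real
  defines "S \<equiv> {X \<in> sets borel. fat (2 * R) X}"
  assumes C: "C \<in> sets borel" "bounded C" and "R \<ge> 1" and "fat R C"
    and \<Phi>: "\<And>v X. envy_free 2 S v X \<Longrightarrow> \<Phi> v X"
  shows "Inf {Sup {Min ((\<lambda>i. VM (v i) (X i) / VM (v i) C) ` {..<2}) | X. allocation C 2 S X \<and> \<Phi> v X}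
      | v. \<forall>i<2. value_density C (v i)} = 1 / 2"
proof -
  define M where "M = (\<lambda>(v :: nat \<Rightarrow> real^'n \<Rightarrow> real) X. Min ((\<lambda>i. VM (v i) (X i) / VM (v i) C) ` {..<2}))"
  define A where "A = (\<lambda>v. {M v X | X. allocation C 2 S X \<and> \<Phi> v X})"
  have S: "S \<subseteq> sets borel" by (auto simp: S_def)
  have near: "\<exists>y\<in>A v. 1 / 2 - \<epsilon> \<le> y" if v: "\<forall>i<2. value_density C (v i)" and "\<epsilon> > 0" for v \<epsilon>
  proof -
    obtain X where "allocation C 2 S X" "envy_free 2 S v X" "1 / 2 - \<epsilon> \<le> M v X"
      unfolding S_def M_def by (rule envy_free_near_half[OF C \<open>R \<ge> 1\<close> \<open>fat R C\<close> v \<open>\<epsilon> > 0\<close>])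
    then show ?thesis using \<Phi> by (auto simp: A_def)
  qed
  \<comment> \<open>The cuts only approach one half, which suffices for a supremum.\<close>
  have lower: "1 / 2 \<le> Sup (A v)" if v: "\<forall>i<2. value_density C (v i)" for v
  proof (rule field_le_epsilon)
    fix \<epsilon> :: real assume "\<epsilon> > 0"
    then obtain y where "y \<in> A v" "1 / 2 - \<epsilon> \<le> y" using near[OF v] by blast
    moreover have "bdd_above (A v)"
      using Min_value_le_1[OF S C(1) v] by (intro bdd_aboveI[of _ 1]) (auto simp: A_def M_def)
    ultimately have "1 / 2 - \<epsilon> \<le> Sup (A v)" by (meson cSup_upper order_trans)
    then show "1 / 2 \<le> Sup (A v) + \<epsilon>" by simp
  qed
  \<comment> \<open>Two uniform agents attain the infimum.\<close>
  define u where "u = (\<lambda>(i::nat) (x::real^'n). 1::real)"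
  have u: "value_density C (u i)" for i
    using value_density_1[OF C \<open>fat R C\<close>] by (simp add: u_def)
  have "Sup (A u) \<le> 1 / 2"
  proof (rule cSup_least)
    \<comment> \<open>The tolerance 1 is arbitrary; only the existence of an allocation is
      used.\<close>
    show "A u \<noteq> {}" using near[of u 1] u by auto
    show "y \<le> 1 / 2" if "y \<in> A u" for y
      using that Min_value_equal_agents[OF S C(1) u[of 0]] by (auto simp: A_def M_def u_def)
  qed
  then have "Sup (A u) = 1 / 2" using lower[of u] u by (auto intro: antisym)
  then have "Inf {Sup (A v) | v. \<forall>i<2. value_density C (v i)} = 1 / 2"
    using lower u by (intro cInf_eq_minimum) (auto intro!: exI[of _ u])
  then show ?thesis by (simp add: A_def M_def)
qed

theorem theorem1:
  fixes C :: "(real^'d) set" and R :: real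
  assumes "CARD('d) \<ge> 2" and "R \<ge> 1"
    and "C \<in> sets borel" and "bounded C" and "fat R C"
  shows "PropEF C 2 {X \<in> sets borel. fat (2 * R) X} = 1 / 2 \<and>
         Prop C 2 {X \<in> sets borel. fat (2 * R) X} = 1 / 2"
proof
  show "PropEF C 2 {X \<in> sets borel. fat (2 * R) X} = 1 / 2"
    unfolding PropEF_def using assms by (intro Inf_Sup_half) auto
  show "Prop C 2 {X \<in> sets borel. fat (2 * R) X} = 1 / 2"
    unfolding Prop_def using Inf_Sup_half[of C R "\<lambda>v X. True"] assms by simp
qed

end
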